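(* Let $X\in\mathbb{R}^{n\times p}$, $Y\in\mathbb{R}^{n\times q}$, $r=\min\{p,q\}$, $\lambda_{\max}=\|X^TY\|_2$, and let $0<\lambda_0\le\lambda_{\max}$. Assume that the dual solution $C^*(\lambda_0)$ at $\lambda_0$ is known, where $C^*(\lambda_0)$ is the Frobenius-norm projection of $Y/\lambda_0$ onto $\Omega_D=\{C\in\mathbb{R}^{n\times q}:\|X^TC\|_2\le1\}$. For any $i\in\{1,2,\dots,r\}$, if $0<\lambda<\lambda_0$ and $$\lambda>\frac{\lambda_0\|X\|_2\|Y\|_F}{2\lambda_0-2\lambda_0\,\sigma_i\Big(X^T\Big(C^*(\lambda_0)+\tfrac12\big(\tfrac1\lambda-\tfrac1{\lambda_0}\big)Y\Big)\Big)+\|X\|_2\|Y\|_F},$$ then the solution $B^*(\lambda)$ of $\min_{B\in\mathbb{R}^{p\times q}}\{\tfrac12\|Y-XB\|_F^2+\lambda\|B\|_*\}$ satisfies $\sigma_j(B^*(\lambda))=0$ for all $j\ge i$. Moreover, $\mathrm{rank}(B^*(\lambda))\le i-1$.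
   Context: For $M\in\mathbb{R}^{p\times q}$, $\sigma_1(M)\ge\dots\ge\sigma_r(M)\ge0$ are its singular values in nonincreasing order. $\|\cdot\|_F$, $\|\cdot\|_*$, $\|\cdot\|_2$ are the Frobenius, nuclear (sum of singular values) and spectral (largest singular value) norms. The matrix $C^*(\lambda_0)$ is the solution of the dual problem $\min_C\{\tfrac{\lambda_0^2}{2}\|C-Y/\lambda_0\|_F^2-\tfrac12\|Y\|_F^2\}$ subject to $\|X^TC\|_2\le1$.
   Formalization: The formal theorem additionally assumes that the denominator in the lower bound for λ is positive; without this the claim fails, e.g. n=p=q=1, X=Y=1, λ_0=1, i=1, λ<1/2, where the bound is negative but B*(λ)=1-λ is nonzero. *)

theory Defs
  imports "HOL-Analysis.Analysis" "HOL-Computational_Algebra.Polynomial"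
    "HOL-Library.Multiset"
begin

text \<open>The library norm on \<^typ>\<open>real^'q^'p\<close> is the Frobenius norm:\<close>

lemma norm_matrix_eq_Frobenius:
  fixes M :: "real^'q^'p"
  shows "norm M = sqrt (\<Sum>i\<in>UNIV. \<Sum>j\<in>UNIV. (M $ i $ j)\<^sup>2)"
  by (simp add: norm_vec_def L2_set_def sum_nonneg)

definition charpoly :: "real^'n^'n \<Rightarrow> real poly" where
  "charpoly A = det (mat [:0, 1:] - map_matrix (\<lambda>a. [:a:]) A)"

text \<open>The \<open>r = min p q\<close> singular values of a \<open>p \<times> q\<close> matrix \<open>M\<close>: the \<open>r\<close> largest among the
  square roots of the \<open>q\<close> eigenvalues of \<open>M\<^sup>T M\<close>, counted with multiplicity and listed in
  nonincreasing order (if \<open>p < q\<close>, the \<open>q - p\<close> dropped ones are zero).\<close>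

definition singular_values :: "real^'q^'p \<Rightarrow> real list" where
  "singular_values M = take (min CARD('p) CARD('q))
     (rev (sorted_list_of_multiset (image_mset sqrt (proots (charpoly (transpose M ** M))))))"

text \<open>Indexing starts at 1; only \<open>1 \<le> i \<le> min p q\<close> is meaningful.\<close>

definition sing_val :: "nat \<Rightarrow> real^'q^'p \<Rightarrow> real" where
  "sing_val i M = singular_values M ! (i - 1)"

definition spectral_norm :: "real^'q^'p \<Rightarrow> real" where
  "spectral_norm M = sing_val 1 M"

definition nuclear_norm :: "real^'q^'p \<Rightarrow> real" where
  "nuclear_norm M = (\<Sum>i = 1..min CARD('p) CARD('q). sing_val i M)"

definition primal_objective :: "real^'p^'n \<Rightarrow> real^'q^'n \<Rightarrow> real \<Rightarrow> real^'q^'p \<Rightarrow> real" where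
  "primal_objective X Y lam B = 1/2 * (norm (Y - X ** B))\<^sup>2 + lam * nuclear_norm B"

text \<open>Minimisers of the primal problem need not be unique if \<open>X\<close> is not injective.\<close>

definition primal_solution :: "real^'p^'n \<Rightarrow> real^'q^'n \<Rightarrow> real \<Rightarrow> real^'q^'p \<Rightarrow> bool" where
  "primal_solution X Y lam B \<longleftrightarrow> is_arg_min (primal_objective X Y lam) (\<lambda>_. True) B"

definition dual_feasible :: "real^'p^'n \<Rightarrow> (real^'q^'n) set" where
  "dual_feasible X = {C. spectral_norm (transpose X ** C) \<le> 1}"

definition dual_objective :: "real^'q^'n \<Rightarrow> real \<Rightarrow> real^'q^'n \<Rightarrow> real" where
  "dual_objective Y lam C = lam\<^sup>2 / 2 * (norm (C - (1/lam) *\<^sub>R Y))\<^sup>2 - 1/2 * (norm Y)\<^sup>2"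

definition dual_solution :: "real^'p^'n \<Rightarrow> real^'q^'n \<Rightarrow> real \<Rightarrow> real^'q^'n \<Rightarrow> bool" where
  "dual_solution X Y lam C \<longleftrightarrow>
     is_arg_min (dual_objective Y lam) (\<lambda>C. C \<in> dual_feasible X) C"

lemma dual_solution_iff_projection:
  assumes "lam > 0"
  shows "dual_solution X Y lam C \<longleftrightarrow>
    is_arg_min (\<lambda>C. dist ((1/lam) *\<^sub>R Y) C) (\<lambda>C. C \<in> dual_feasible X) C"
proof -
  have "dual_objective Y lam D < dual_objective Y lam C \<longleftrightarrow>
      dist ((1/lam) *\<^sub>R Y) D < dist ((1/lam) *\<^sub>R Y) C" for C D
  proof -
    have "dual_objective Y lam D < dual_objective Y lam C \<longleftrightarrow>
        (norm (D - (1/lam) *\<^sub>R Y))\<^sup>2 < (norm (C - (1/lam) *\<^sub>R Y))\<^sup>2"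
      using assms by (simp add: dual_objective_def)
    also have "\<dots> \<longleftrightarrow> norm (D - (1/lam) *\<^sub>R Y) < norm (C - (1/lam) *\<^sub>R Y)"
      by (simp add: power_mono_iff power_strict_mono linorder_not_le[symmetric])
    finally show ?thesis
      by (simp add: dist_norm norm_minus_commute)
  qed
  then show ?thesis
    by (simp add: dual_solution_def is_arg_min_def)
qed

end

theory Submission
  imports Defs
begin

text \<open>A minimiser \<open>B\<close> of the primal problem gives the dual optimum \<open>C = (Y - X B) / \<lambda>\<close>, and
  \<open>X\<^sup>T C\<close> is a subgradient of the nuclear norm at \<open>B\<close>: a contraction that is isometric on the
  span of the right singular vectors of \<open>B\<close> with nonzero singular value. If \<open>B\<close> had at least
  \<open>i\<close> nonzero singular values, \<open>X\<^sup>T C\<close> would thus be isometric on a subspace of dimension \<open>i\<close>.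
  Since \<open>C\<close> and \<open>C0\<close> are projections of \<open>Y / \<lambda>\<close> and \<open>Y / \<lambda>\<^sub>0\<close> onto the same convex set, firm
  nonexpansiveness places \<open>C\<close> in the ball with centre \<open>M = C0 + (1 / \<lambda> - 1 / \<lambda>\<^sub>0) Y / 2\<close> and radius
  \<open>(1 / \<lambda> - 1 / \<lambda>\<^sub>0) \<parallel>Y\<parallel> / 2\<close>, so the Courant--Fischer principle bounds \<open>\<sigma>\<^sub>i(X\<^sup>T M)\<close> from below
  and contradicts the assumption on \<open>\<lambda>\<close>.\<close>

section \<open>Elementary inequalities for first-order arguments\<close>

text \<open>Dividing by \<open>t\<close> gives \<open>a \<le> t * c\<close>, and \<open>t\<close>
  may tend to 0. This extracts first-order optimality conditions from perturbations; the range
  \<open>t \<le> 1\<close> later makes \<open>1 - t\<close> a nonnegative scaling factor.\<close>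

lemma nonpos_if_quadratic_bound:
  fixes a c :: real
  assumes "\<And>t. 0 < t \<Longrightarrow> t \<le> 1 \<Longrightarrow> t * a \<le> t\<^sup>2 * c"
  shows "a \<le> 0"
proof (rule ccontr)
  assume "\<not> a \<le> 0"
  then have a: "a > 0" by simp
  \<comment> \<open>Chosen so that \<open>t * (\<bar>c\<bar> + 1) \<le> a / 2\<close>, which
    contradicts \<open>a \<le> t * c\<close>; the \<open>+ 1\<close> keeps the denominator positive
    when \<open>c = 0\<close>.\<close>
  define t where "t = min 1 (a / (\<bar>c\<bar> + 1) / 2)"
  have t: "0 < t" "t \<le> 1" "t \<le> a / (\<bar>c\<bar> + 1) / 2"
    using a by (auto simp: t_def)
  have "t * a \<le> t * (t * c)"
    using assms[OF t(1,2)] by (simp add: power2_eq_square mult.assoc)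
  then have "a \<le> t * c"
    using t(1) by simp
  also have "\<dots> \<le> t * (\<bar>c\<bar> + 1)"
    using t(1) by (intro mult_left_mono) auto
  also have "\<dots> \<le> a / (\<bar>c\<bar> + 1) / 2 * (\<bar>c\<bar> + 1)"
    using t(3) by (intro mult_right_mono) auto
  also have "\<dots> = a / 2"
    by (simp add: field_simps)
  finally show False using a by simp
qed

lemma power2_norm_diff:
  fixes x y :: "'a::real_inner"
  shows "(norm (x - y))\<^sup>2 = (norm x)\<^sup>2 - 2 * (x \<bullet> y) + (norm y)\<^sup>2"
  using dot_norm_neg[of x y] by simp

section \<open>The spectral theorem for self-adjoint maps\<close>

text \<open>A maximiser \<open>v\<close> of the Rayleigh quotient on the unit sphere of
  \<open>S\<close>, with maximum \<open>c\<close>, is an eigenvector: moving \<open>v\<close> along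
  the residual \<open>f v - c v\<close> changes the quadratic form to first order by twice the
  squared norm of that residual, which must therefore vanish.\<close>

lemma self_adjoint_has_eigenvector:
  fixes f :: "'a::euclidean_space \<Rightarrow> 'a"
  assumes f: "linear f" and adj: "\<And>x y. f x \<bullet> y = x \<bullet> f y"
    and S: "subspace S" "f ` S \<subseteq> S" "S \<noteq> {0}"
  obtains v c where "v \<in> S" "norm v = 1" "f v = c *\<^sub>R v"
proof -
  obtain y where y: "y \<in> S" "y \<noteq> 0"
    using S(1,3) subspace_0 by blast
  then have "(1 / norm y) *\<^sub>R y \<in> S \<inter> sphere 0 1"
    using S(1) by (simp add: subspace_scale)
  then have "S \<inter> sphere 0 1 \<noteq> {}" by blast
  moreover have "compact (S \<inter> sphere 0 1)"
    using S(1) closed_subspace by (metis closed_Int_compact compact_sphere)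
  moreover have "continuous_on (S \<inter> sphere 0 1) (\<lambda>x. x \<bullet> f x)"
    using f by (intro continuous_intros linear_continuous_on) (simp add: linear_conv_bounded_linear)
  ultimately obtain v where v: "v \<in> S" "norm v = 1"
    and max: "\<And>x. x \<in> S \<Longrightarrow> norm x = 1 \<Longrightarrow> x \<bullet> f x \<le> v \<bullet> f v"
    using continuous_attains_sup[of "S \<inter> sphere 0 1" "\<lambda>x. x \<bullet> f x"] by fastforce
  define c where "c = v \<bullet> f v"
  have bound: "x \<bullet> f x \<le> c * (x \<bullet> x)" if "x \<in> S" for x
  proof (cases "x = 0")
    case False
    have "((1 / norm x) *\<^sub>R x) \<bullet> f ((1 / norm x) *\<^sub>R x) \<le> c"
      unfolding c_def using that False S(1) by (intro max) (auto simp: subspace_scale)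
    then have "(x \<bullet> f x) / (norm x)\<^sup>2 \<le> c"
      using f by (simp add: linear_scale power2_eq_square field_simps)
    then show ?thesis
      using False by (simp add: field_simps dot_square_norm)
  qed (use f in \<open>simp add: linear_0\<close>)
  define w where "w = f v - c *\<^sub>R v"
  have w: "w \<in> S"
    unfolding w_def using v S by (intro subspace_diff subspace_scale) auto
  \<comment> \<open>Expand \<open>bound\<close> at \<open>v + t w\<close>: the terms free of
    \<open>t\<close> cancel by the choice of \<open>c\<close>, and self-adjointness merges the two
    mixed terms.\<close>
  have "t * (2 * (w \<bullet> w)) \<le> t\<^sup>2 * (c * (w \<bullet> w) - w \<bullet> f w)" for t
  proof -
    have "(v + t *\<^sub>R w) \<bullet> f (v + t *\<^sub>R w) \<le> c * ((v + t *\<^sub>R w) \<bullet> (v + t *\<^sub>R w))"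
      using v w S by (intro bound subspace_add subspace_scale)
    moreover have "v \<bullet> f w = w \<bullet> f v"
      by (metis adj inner_commute)
    moreover have "v \<bullet> v = 1"
      using v by (simp add: dot_square_norm)
    ultimately have "2 * t * (w \<bullet> f v - c * (w \<bullet> v)) \<le> t\<^sup>2 * (c * (w \<bullet> w) - w \<bullet> f w)"
      using f by (simp add: linear_add linear_scale inner_add_left inner_add_right c_def
        inner_commute[of v w] power2_eq_square algebra_simps)
    moreover have "w \<bullet> f v - c * (w \<bullet> v) = w \<bullet> w"
      by (simp add: w_def inner_diff_right)
    ultimately show ?thesis by (simp add: algebra_simps)
  qed
  then have "w \<bullet> w \<le> 0"
    using nonpos_if_quadratic_bound[of "2 * (w \<bullet> w)" "c * (w \<bullet> w) - w \<bullet> f w"] by simp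
  then have "w = 0"
    by (metis inner_eq_zero_iff inner_ge_zero order_antisym)
  then have "f v = c *\<^sub>R v"
    by (simp add: w_def)
  with v that show ?thesis by blast
qed

text \<open>Induction on the dimension: self-adjointness makes the orthogonal complement of an
  eigenvector within \<open>S\<close> invariant again, and it is a proper subspace of
  \<open>S\<close>.\<close>

lemma self_adjoint_eigenbasis_subspace:
  fixes f :: "'a::euclidean_space \<Rightarrow> 'a"
  assumes f: "linear f" and adj: "\<And>x y. f x \<bullet> y = x \<bullet> f y"
    and "subspace S" "f ` S \<subseteq> S"
  shows "\<exists>B. B \<subseteq> S \<and> S \<subseteq> span B \<and> pairwise orthogonal B \<and> (\<forall>b\<in>B. norm b = 1 \<and> (\<exists>c. f b = c *\<^sub>R b))"
  using assms(3,4)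
proof (induction "dim S" arbitrary: S rule: less_induct)
  case less
  show ?case
  proof (cases "S = {0}")
    case True
    then show ?thesis by (intro exI[of _ "{}"]) auto
  next
    case False
    obtain v c where v: "v \<in> S" "norm v = 1" "f v = c *\<^sub>R v"
      using self_adjoint_has_eigenvector[OF f adj less.prems False] by blast
    define T where "T = {x \<in> S. v \<bullet> x = 0}"
    have T: "subspace T"
      using less.prems(1) by (auto simp: T_def subspace_def inner_add_right)
    have "v \<bullet> f x = c * (v \<bullet> x)" for x
      using adj[of v x] v(3) by simp
    then have fT: "f ` T \<subseteq> T"
      using less.prems(2) by (auto simp: T_def)
    have "v \<notin> T"
      using v(2) by (auto simp: T_def)
    moreover have "T \<subseteq> S"
      by (auto simp: T_def)
    ultimately have "T \<subset> S"
      using v(1) by blast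
    then have "dim T < dim S"
      using dim_psubset[of T S] T less.prems(1) by (simp add: span_eq_iff[THEN iffD2])
    then obtain B where B: "B \<subseteq> T" "T \<subseteq> span B" "pairwise orthogonal B"
      "\<forall>b\<in>B. norm b = 1 \<and> (\<exists>c. f b = c *\<^sub>R b)"
      using less.hyps[OF _ T fT] by blast
    have "S \<subseteq> span (insert v B)"
    proof
      fix x assume "x \<in> S"
      then have "x - (v \<bullet> x) *\<^sub>R v \<in> T"
        using v less.prems(1)
        by (auto simp: T_def subspace_diff subspace_scale inner_diff_right dot_square_norm)
      with B(2) show "x \<in> span (insert v B)"
        by (auto simp: span_insert)
    qed
    moreover have "pairwise orthogonal (insert v B)"
      using B(1,3) by (auto simp: pairwise_insert T_def orthogonal_def inner_commute)
    ultimately show ?thesis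
      using B v by (intro exI[of _ "insert v B"]) (auto simp: T_def)
  qed
qed

section \<open>Orthonormal bases indexed by the coordinate type\<close>

text \<open>Indexing by \<open>'q\<close> itself gives the family as many members as the dimension,
  so orthonormality alone already makes it a basis.\<close>

definition orthonormal :: "('q \<Rightarrow> real^'q) \<Rightarrow> bool" where
  "orthonormal v \<longleftrightarrow> (\<forall>j k. v j \<bullet> v k = (if j = k then 1 else 0))"

lemma self_adjoint_eigenbasis:
  fixes f :: "real^'q \<Rightarrow> real^'q"
  assumes f: "linear f" and adj: "\<And>x y. f x \<bullet> y = x \<bullet> f y"
  obtains v \<mu> where "orthonormal v" "\<And>k. f (v k) = \<mu> k *\<^sub>R v k"
proof -
  obtain B where B: "UNIV \<subseteq> span B" "pairwise orthogonal B"
    "\<forall>b\<in>B. norm b = 1 \<and> (\<exists>c. f b = c *\<^sub>R b)"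
    using self_adjoint_eigenbasis_subspace[OF f adj subspace_UNIV] by auto
  have indep: "independent B"
    using B by (intro pairwise_orthogonal_independent) auto
  have "card B = CARD('q)"
    using basis_card_eq_dim[of B UNIV] indep B(1) by (simp add: dim_UNIV)
  moreover have "finite B"
    using indep independent_imp_finite by blast
  ultimately obtain v where v: "bij_betw v (UNIV :: 'q set) B"
    using finite_same_card_bij[of "UNIV :: 'q set" B] by auto
  have "\<exists>c. f (v k) = c *\<^sub>R v k" for k
    using B(3) v by (auto simp: bij_betw_def)
  then obtain \<mu> where "\<And>k. f (v k) = \<mu> k *\<^sub>R v k" by metis
  moreover have "orthonormal v"
    unfolding orthonormal_def
  proof (intro allI)
    fix j k
    have mem: "v j \<in> B" "v k \<in> B" and inj: "v j = v k \<longleftrightarrow> j = k"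
      using v by (auto simp: bij_betw_def inj_on_def)
    show "v j \<bullet> v k = (if j = k then 1 else 0)"
      using B(2,3) mem inj by (auto simp: pairwise_def orthogonal_def dot_square_norm)
  qed
  ultimately show ?thesis using that by blast
qed

text \<open>For the square matrix \<open>V\<close> with rows \<open>v i\<close>, orthonormality says
  that the transpose is a right inverse, hence also a left inverse; the latter fact is the
  expansion.\<close>

lemma orthonormal_expansion:
  assumes "orthonormal v"
  shows "x = (\<Sum>k\<in>UNIV. (x \<bullet> v k) *\<^sub>R v k)"
proof -
  define V where "V = (\<chi> i. v i)"
  have "V ** transpose V = mat 1"
    using assms by (simp add: V_def vec_eq_iff matrix_matrix_mult_def transpose_def mat_def
        orthonormal_def inner_vec_def)
  then have "transpose V ** V = mat 1"
    using matrix_left_right_inverse by blast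
  then have "x = transpose V *v (V *v x)"
    by (simp add: matrix_vector_mul_assoc)
  also have "\<dots> = (\<Sum>k\<in>UNIV. (x \<bullet> v k) *\<^sub>R v k)"
    by (simp add: vec_eq_iff matrix_vector_mult_def transpose_def V_def inner_vec_def mult.commute)
  finally show ?thesis .
qed

lemma orthonormal_inner:
  assumes "orthonormal v"
  shows "x \<bullet> y = (\<Sum>k\<in>UNIV. (x \<bullet> v k) * (y \<bullet> v k))"
proof -
  have "x \<bullet> y = (\<Sum>k\<in>UNIV. (x \<bullet> v k) *\<^sub>R v k) \<bullet> y"
    using orthonormal_expansion[OF assms, of x] by simp
  also have "\<dots> = (\<Sum>k\<in>UNIV. (x \<bullet> v k) * (v k \<bullet> y))"
    by (simp only: inner_sum_left inner_scaleR_left)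
  finally show ?thesis
    by (simp add: inner_commute)
qed

lemma orthonormal_dim_span:
  assumes "orthonormal v"
  shows "dim (span (v ` K)) = card K"
proof -
  have inj: "inj v"
    using assms by (metis orthonormal_def injI zero_neq_one)
  have "pairwise orthogonal (v ` K)" "0 \<notin> v ` K"
    using assms by (auto simp: orthonormal_def pairwise_def orthogonal_def) (metis inner_zero_left zero_neq_one)
  then have "independent (v ` K)"
    by (rule pairwise_orthogonal_independent)
  then have "dim (span (v ` K)) = card (v ` K)"
    by (simp add: dim_eq_card_independent)
  then show ?thesis
    using inj by (simp add: card_image inj_on_def)
qed

lemma orthonormal_inner_span_eq_0:
  assumes "orthonormal v" "x \<in> span (v ` K)" "k \<notin> K"
  shows "x \<bullet> v k = 0"
proof -
  have "subspace {x. x \<bullet> v k = 0}"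
    by (auto simp: subspace_def inner_add_left)
  then have "span (v ` K) \<subseteq> {x. x \<bullet> v k = 0}"
    using assms by (intro span_minimal) (auto simp: orthonormal_def)
  then show ?thesis using assms by blast
qed

section \<open>The characteristic polynomial of a matrix with an orthonormal eigenbasis\<close>

lemma map_matrix_const_mult:
  "map_matrix (\<lambda>a. [:a:]) (A ** B) = map_matrix (\<lambda>a. [:a:]) A ** map_matrix (\<lambda>a. [:a::real:]) B"
  by (simp add: vec_eq_iff matrix_matrix_mult_def mult_to_poly sum_to_poly mult.commute)

text \<open>Diagonalisation, lifted to constant polynomial matrices, makes \<open>x - A\<close>
  similar to \<open>x - D\<close>. The factorisation ties the roots with multiplicity, on which the
  singular values are defined, to an arbitrary eigenbasis.\<close>

lemma charpoly_eigenbasis: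
  fixes A :: "real^'q^'q"
  assumes v: "orthonormal v" and \<mu>: "\<And>k. A *v v k = \<mu> k *\<^sub>R v k"
  shows "charpoly A = (\<Prod>k\<in>UNIV. [:- \<mu> k, 1:])"
proof -
  let ?c = "map_matrix (\<lambda>a. [:a::real:])"
  let ?x = "mat [:0, 1:] :: real poly^'q^'q"
  define V where "V = (\<chi> i. v i)"
  define D where "D = (\<chi> i j. if i = j then \<mu> i else 0)"
  have VV: "V ** transpose V = mat 1"
    using v by (simp add: V_def vec_eq_iff matrix_matrix_mult_def transpose_def mat_def
        orthonormal_def inner_vec_def)
  have AV: "A ** transpose V = transpose V ** D"
  proof -
    have "(\<Sum>k\<in>UNIV. A $ i $ k * v j $ k) = \<mu> j * v j $ i" for i j
      using \<mu>[of j] by (simp add: vec_eq_iff matrix_vector_mult_def)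
    then show ?thesis
      by (simp add: V_def D_def vec_eq_iff matrix_matrix_mult_def transpose_def if_distrib mult.commute cong: if_cong)
  qed
  \<comment> \<open>The scalar matrix \<open>?x\<close> commutes with every matrix, so the relation
    \<open>AV\<close> between \<open>A\<close> and \<open>D\<close> passes to
    \<open>?x - ?c A\<close> and \<open>?x - ?c D\<close>.\<close>
  have eq: "(?x - ?c A) ** ?c (transpose V) = ?c (transpose V) ** (?x - ?c D)"
  proof -
    have "(?x - ?c A) ** M = ?x ** M - ?c A ** M" "M ** (?x - ?c D) = M ** ?x - M ** ?c D" for M
      by (simp_all add: vec_eq_iff matrix_matrix_mult_def sum_subtractf algebra_simps)
    moreover have "?x ** M = M ** ?x" for M
      by (simp add: vec_eq_iff matrix_matrix_mult_def mat_def if_distrib if_distribR mult.commute cong: if_cong)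
    ultimately show ?thesis
      by (simp add: map_matrix_const_mult[symmetric] AV)
  qed
  have "det (?c V) * det (?c (transpose V)) = det (?c (mat 1 :: real^'q^'q))"
    by (simp add: det_mul[symmetric] map_matrix_const_mult[symmetric] VV)
  also have "?c (mat 1 :: real^'q^'q) = mat 1"
    by (simp add: vec_eq_iff mat_def)
  finally have "det (?c (transpose V)) \<noteq> 0"
    by auto
  moreover have "charpoly A * det (?c (transpose V)) = det (?x - ?c D) * det (?c (transpose V))"
    using arg_cong[OF eq, of det] by (simp add: det_mul charpoly_def mult.commute)
  ultimately have "charpoly A = det (?x - ?c D)"
    by simp
  also have "\<dots> = (\<Prod>k\<in>UNIV. (?x - ?c D) $ k $ k)"
    by (rule det_diagonal) (auto simp: mat_def D_def)
  also have "\<dots> = (\<Prod>k\<in>UNIV. [:- \<mu> k, 1:])"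
    by (simp add: mat_def D_def)
  finally show ?thesis .
qed

section \<open>Singular values via right singular vectors\<close>

lemma transpose_inner:
  fixes A :: "real^'q^'p"
  shows "(transpose A *v y) \<bullet> x = y \<bullet> (A *v x)"
  by (metis dot_lmul_matrix vector_transpose_matrix transpose_transpose)

text \<open>An orthonormal eigenbasis of the Gram matrix, with the eigenvalues written as
  \<open>(norm (A *v v k))\<^sup>2\<close>; the singular values are thus the norms of the images, in
  no prescribed order.\<close>

definition right_singular_basis :: "real^'q^'p \<Rightarrow> ('q \<Rightarrow> real^'q) \<Rightarrow> bool" where
  "right_singular_basis A v \<longleftrightarrow> orthonormal v \<and>
     (\<forall>k. transpose A ** A *v v k = (norm (A *v v k))\<^sup>2 *\<^sub>R v k)"

lemma right_singular_basis_exists: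
  fixes A :: "real^'q^'p"
  obtains v where "right_singular_basis A v"
proof -
  have "(transpose A ** A *v x) \<bullet> y = x \<bullet> (transpose A ** A *v y)" for x y
    by (metis inner_commute matrix_vector_mul_assoc transpose_inner)
  then obtain v \<mu> where v: "orthonormal v" and \<mu>: "\<And>k. transpose A ** A *v v k = \<mu> k *\<^sub>R v k"
    using self_adjoint_eigenbasis[of "(*v) (transpose A ** A)"] by blast
  have "\<mu> k = (norm (A *v v k))\<^sup>2" for k
  proof -
    have "\<mu> k = (transpose A ** A *v v k) \<bullet> v k"
      using v by (simp add: \<mu> orthonormal_def)
    also have "\<dots> = (norm (A *v v k))\<^sup>2"
      by (simp only: matrix_vector_mul_assoc[symmetric] transpose_inner dot_square_norm)
    finally show ?thesis .
  qed
  with v \<mu> that show ?thesis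
    by (metis right_singular_basis_def)
qed

text \<open>The images \<open>A *v v k\<close> are, up to normalisation, the left singular
  vectors.\<close>

lemma right_singular_basis_inner:
  assumes "right_singular_basis A v"
  shows "(A *v v j) \<bullet> (A *v v k) = (if j = k then (norm (A *v v k))\<^sup>2 else 0)"
proof -
  have "(A *v v j) \<bullet> (A *v v k) = (transpose A ** A *v v j) \<bullet> v k"
    by (simp only: matrix_vector_mul_assoc[symmetric] transpose_inner)
  then show ?thesis
    using assms by (simp add: right_singular_basis_def orthonormal_def)
qed

lemma norm_mult_right_singular_basis:
  assumes "right_singular_basis A v"
  shows "(norm (A *v x))\<^sup>2 = (\<Sum>k\<in>UNIV. (norm (A *v v k))\<^sup>2 * (x \<bullet> v k)\<^sup>2)"
proof -
  have v: "orthonormal v"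
    using assms by (simp add: right_singular_basis_def)
  have "(norm (A *v x))\<^sup>2 = x \<bullet> (transpose A ** A *v x)"
    by (metis dot_square_norm inner_commute matrix_vector_mul_assoc transpose_inner)
  also have "\<dots> = (\<Sum>k\<in>UNIV. (x \<bullet> v k) * ((transpose A ** A *v x) \<bullet> v k))"
    by (rule orthonormal_inner[OF v])
  also have "\<dots> = (\<Sum>k\<in>UNIV. (norm (A *v v k))\<^sup>2 * (x \<bullet> v k)\<^sup>2)"
  proof (rule sum.cong)
    fix k
    have "(transpose A ** A *v x) \<bullet> v k = x \<bullet> (transpose A ** A *v v k)"
      by (metis inner_commute matrix_vector_mul_assoc transpose_inner)
    then show "(x \<bullet> v k) * ((transpose A ** A *v x) \<bullet> v k) = (norm (A *v v k))\<^sup>2 * (x \<bullet> v k)\<^sup>2"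
      using assms by (simp add: right_singular_basis_def power2_eq_square)
  qed simp
  finally show ?thesis .
qed

text \<open>The nonzero images are pairwise orthogonal, hence independent in a space of dimension
  \<open>CARD('p)\<close>. This justifies cutting the list of singular values at
  \<open>min CARD('p) CARD('q)\<close>.\<close>

lemma card_nonzero_singular_le:
  fixes A :: "real^'q^'p"
  assumes "right_singular_basis A v"
  shows "card {k. A *v v k \<noteq> 0} \<le> min CARD('p) CARD('q)"
proof -
  let ?K = "{k. A *v v k \<noteq> 0}"
  have ortho: "(A *v v j) \<bullet> (A *v v k) = 0" if "j \<noteq> k" for j k
    using right_singular_basis_inner[OF assms, of j k] that by simp
  have "inj_on (\<lambda>k. A *v v k) ?K"
  proof (rule inj_onI)
    fix j k assume "j \<in> ?K" "A *v v j = A *v v k"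
    then show "j = k" using ortho[of j k] by fastforce
  qed
  moreover have "independent ((\<lambda>k. A *v v k) ` ?K)"
    by (rule pairwise_orthogonal_independent)
      (auto simp: pairwise_def orthogonal_def intro!: ortho)
  ultimately have "card ?K \<le> CARD('p)"
    using independent_card_le[of "(\<lambda>k. A *v v k) ` ?K"] by (simp add: card_image)
  moreover have "card ?K \<le> CARD('q)"
    by (rule card_mono) auto
  ultimately show ?thesis by simp
qed

lemma rank_le_card_nonzero_singular:
  assumes "right_singular_basis A v"
  shows "rank A \<le> card {k. A *v v k \<noteq> 0}"
proof -
  let ?K = "{k. A *v v k \<noteq> 0}"
  have v: "orthonormal v"
    using assms by (simp add: right_singular_basis_def)
  have "A *v x \<in> span ((\<lambda>k. A *v v k) ` ?K)" for x
  proof -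
    have "A *v x = A *v (\<Sum>k\<in>UNIV. (x \<bullet> v k) *\<^sub>R v k)"
      using orthonormal_expansion[OF v, of x] by simp
    also have "\<dots> = (\<Sum>k\<in>UNIV. (x \<bullet> v k) *\<^sub>R (A *v v k))"
      by (simp add: linear_sum matrix_vector_mult_scaleR)
    also have "\<dots> \<in> span ((\<lambda>k. A *v v k) ` ?K)"
      by (intro span_sum span_scale) (metis (mono_tags, lifting) imageI mem_Collect_eq span_base span_zero)
    finally show ?thesis .
  qed
  then have "rank A \<le> dim ((\<lambda>k. A *v v k) ` ?K)"
    unfolding rank_dim_range by (intro dim_mono) auto
  also have "\<dots> \<le> card ((\<lambda>k. A *v v k) ` ?K)"
    by (intro dim_le_card') auto
  also have "\<dots> \<le> card ?K"
    by (intro card_image_le) auto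
  finally show ?thesis .
qed

section \<open>Ordered singular values by counting above a threshold\<close>

text \<open>In a nonincreasing list the entries that are at least \<open>t\<close> form a prefix.
  Counting them replaces any ordering of the basis vectors.\<close>

lemma le_nth_sorted_desc_iff:
  assumes "sorted (rev xs)" "i < length xs"
  shows "t \<le> xs ! i \<longleftrightarrow> i < length (filter (\<lambda>x. t \<le> x) xs)"
  using assms
proof (induction xs arbitrary: i)
  case (Cons x xs)
  have hd: "\<forall>y\<in>set xs. y \<le> x" and tl: "sorted (rev xs)"
    using Cons.prems(1) by (auto simp: sorted_append)
  show ?case
  proof (cases "t \<le> x")
    case True
    with Cons.IH[OF tl] Cons.prems(2) show ?thesis
      by (cases i) auto
  next
    case False
    then have "filter (\<lambda>x. t \<le> x) (x # xs) = []"
      using hd by (auto simp: filter_empty_conv)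
    moreover have "(x # xs) ! i \<le> x"
      using hd Cons.prems(2) by (cases i) auto
    ultimately show ?thesis using False by (simp del: filter.simps)
  qed
qed simp

text \<open>The list before truncation: it has one entry per vector of a right singular basis, so
  the two can be compared as multisets.\<close>

definition all_singular_values :: "real^'q^'p \<Rightarrow> real list" where
  "all_singular_values A =
     rev (sorted_list_of_multiset (image_mset sqrt (proots (charpoly (transpose A ** A)))))"

lemma mset_all_singular_values:
  assumes "right_singular_basis A v"
  shows "mset (all_singular_values A) = image_mset (\<lambda>k. norm (A *v v k)) (mset_set UNIV)"
proof -
  have "charpoly (transpose A ** A) = (\<Prod>k\<in>UNIV. [:- (norm (A *v v k))\<^sup>2, 1:])"
    using assms by (intro charpoly_eigenbasis) (auto simp: right_singular_basis_def)
  then have "proots (charpoly (transpose A ** A)) = (\<Sum>k\<in>UNIV. {#(norm (A *v v k))\<^sup>2#})"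
    by (simp add: proots_prod)
  also have "\<dots> = image_mset (\<lambda>k. (norm (A *v v k))\<^sup>2) (mset_set UNIV)"
    by (simp add: sum_unfold_sum_mset)
  finally show ?thesis
    by (simp add: all_singular_values_def multiset.map_comp o_def)
qed

lemma length_all_singular_values: "length (all_singular_values (A :: real^'q^'p)) = CARD('q)"
proof -
  obtain v where "right_singular_basis A v" by (rule right_singular_basis_exists)
  then show ?thesis
    using arg_cong[OF mset_all_singular_values, of A v size] by simp
qed

lemma le_all_singular_values_iff:
  fixes A :: "real^'q^'p"
  assumes v: "right_singular_basis A v" and i: "i < CARD('q)"
  shows "t \<le> all_singular_values A ! i \<longleftrightarrow> i < card {k. t \<le> norm (A *v v k)}"
proof -
  have "length (filter (\<lambda>x. t \<le> x) (all_singular_values A))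
      = size (filter_mset (\<lambda>x. t \<le> x) (mset (all_singular_values A)))"
    by (simp flip: mset_filter)
  also have "\<dots> = card {k. t \<le> norm (A *v v k)}"
    by (simp add: mset_all_singular_values[OF v] filter_mset_image_mset)
  finally show ?thesis
    using i by (subst le_nth_sorted_desc_iff)
      (simp_all add: length_all_singular_values, simp add: all_singular_values_def)
qed

lemma sing_val_eq_all_singular_values:
  fixes A :: "real^'q^'p"
  assumes "1 \<le> i" "i \<le> min CARD('p) CARD('q)"
  shows "sing_val i A = all_singular_values A ! (i - 1)"
proof -
  have "i - 1 < min CARD('p) CARD('q)"
    using assms by linarith
  then show ?thesis
    unfolding sing_val_def singular_values_def all_singular_values_def by (rule nth_take)
qed

text \<open>The shift from list positions starting at 0 to indices starting at 1 turns the strict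
  inequality on the count into a weak one.\<close>

lemma le_sing_val_iff_card:
  fixes A :: "real^'q^'p"
  assumes v: "right_singular_basis A v" and i: "1 \<le> i" "i \<le> min CARD('p) CARD('q)"
  shows "t \<le> sing_val i A \<longleftrightarrow> i \<le> card {k. t \<le> norm (A *v v k)}"
  using le_all_singular_values_iff[OF v, of "i - 1" t] i
  by (simp add: sing_val_eq_all_singular_values) linarith

lemma nuclear_norm_eq_sum:
  fixes A :: "real^'q^'p"
  assumes v: "right_singular_basis A v"
  shows "nuclear_norm A = (\<Sum>k\<in>UNIV. norm (A *v v k))"
proof -
  let ?L = "all_singular_values A" and ?r = "min CARD('p) CARD('q)"
  have nonneg: "0 \<le> ?L ! i" if "i < CARD('q)" for i
    using le_all_singular_values_iff[OF v that, of 0] that by simp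
  \<comment> \<open>A positive entry at a position \<open>i \<ge> ?r\<close> would force more than
    \<open>?r\<close> nonzero images; hence truncation does not change the sum.\<close>
  have zero: "?L ! i = 0" if "?r \<le> i" "i < CARD('q)" for i
  proof (rule ccontr)
    assume "?L ! i \<noteq> 0"
    with nonneg[OF that(2)] have pos: "0 < ?L ! i" by simp
    have "i < card {k. ?L ! i \<le> norm (A *v v k)}"
      using le_all_singular_values_iff[OF v that(2), of "?L ! i"] by simp
    also have "\<dots> \<le> card {k. A *v v k \<noteq> 0}"
      using pos by (intro card_mono) auto
    finally show False
      using card_nonzero_singular_le[OF v] that(1) by simp
  qed
  have "nuclear_norm A = (\<Sum>i\<in>{1..?r}. ?L ! (i - 1))"
    unfolding nuclear_norm_def by (intro sum.cong) (auto simp: sing_val_eq_all_singular_values)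
  also have "\<dots> = (\<Sum>i<?r. ?L ! i)"
    by (rule sum.reindex_bij_witness[of _ Suc "\<lambda>i. i - 1"]) auto
  also have "\<dots> = (\<Sum>i<CARD('q). ?L ! i)"
    using zero by (intro sum.mono_neutral_left) auto
  also have "\<dots> = sum_mset (mset ?L)"
    by (simp add: sum_mset_sum_list sum_list_sum_nth length_all_singular_values lessThan_atLeast0)
  also have "\<dots> = (\<Sum>k\<in>UNIV. norm (A *v v k))"
    by (simp add: mset_all_singular_values[OF v] sum_unfold_sum_mset)
  finally show ?thesis .
qed

section \<open>Courant--Fischer characterisation of singular values\<close>

text \<open>Let \<open>?K\<close> index the basis vectors stretched by at least \<open>t\<close>.
  Their span is a witness for \<open>S\<close>; conversely, any such \<open>S\<close> meets the span
  of the remaining vectors only in 0, so its dimension is at most \<open>card ?K\<close>.\<close>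

lemma le_sing_val_iff_subspace:
  fixes A :: "real^'q^'p"
  assumes i: "1 \<le> i" "i \<le> min CARD('p) CARD('q)"
  shows "t \<le> sing_val i A \<longleftrightarrow> (\<exists>S. subspace S \<and> i \<le> dim S \<and> (\<forall>x\<in>S. t * norm x \<le> norm (A *v x)))"
proof
  obtain v where v: "right_singular_basis A v" by (rule right_singular_basis_exists)
  then have on: "orthonormal v" by (simp add: right_singular_basis_def)
  have norm_sq: "(norm x)\<^sup>2 = (\<Sum>k\<in>UNIV. (x \<bullet> v k)\<^sup>2)" for x
    using orthonormal_inner[OF on, of x x] by (simp add: dot_square_norm power2_eq_square)
  note image_sq = norm_mult_right_singular_basis[OF v]
  let ?K = "{k. t \<le> norm (A *v v k)}"
  {
    assume "t \<le> sing_val i A"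
    then have "i \<le> dim (span (v ` ?K))"
      using le_sing_val_iff_card[OF v i] orthonormal_dim_span[OF on] by simp
    moreover have "t * norm x \<le> norm (A *v x)" if x: "x \<in> span (v ` ?K)" for x
    proof (cases "t \<le> 0")
      case True
      then have "t * norm x \<le> 0" by (simp add: mult_nonpos_nonneg)
      also have "0 \<le> norm (A *v x)" by simp
      finally show ?thesis .
    next
      case False
      have "(t * norm x)\<^sup>2 = (\<Sum>k\<in>UNIV. t\<^sup>2 * (x \<bullet> v k)\<^sup>2)"
        by (simp add: power_mult_distrib norm_sq sum_distrib_left)
      also have "\<dots> \<le> (\<Sum>k\<in>UNIV. (norm (A *v v k))\<^sup>2 * (x \<bullet> v k)\<^sup>2)"
      proof (rule sum_mono)
        fix k
        show "t\<^sup>2 * (x \<bullet> v k)\<^sup>2 \<le> (norm (A *v v k))\<^sup>2 * (x \<bullet> v k)\<^sup>2"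
        proof (cases "k \<in> ?K")
          case True
          then show ?thesis
            using False by (intro mult_right_mono power_mono) auto
        qed (simp add: orthonormal_inner_span_eq_0[OF on x])
      qed
      also have "\<dots> = (norm (A *v x))\<^sup>2"
        by (rule image_sq[symmetric])
      finally show ?thesis
        by (rule power2_le_imp_le) simp
    qed
    ultimately show "\<exists>S. subspace S \<and> i \<le> dim S \<and> (\<forall>x\<in>S. t * norm x \<le> norm (A *v x))"
      using subspace_span by blast
  next
    assume "\<exists>S. subspace S \<and> i \<le> dim S \<and> (\<forall>x\<in>S. t * norm x \<le> norm (A *v x))"
    then obtain S where S: "subspace S" "i \<le> dim S" "\<And>x. x \<in> S \<Longrightarrow> t * norm x \<le> norm (A *v x)"
      by blast
    \<comment> \<open>Nonzero vectors of \<open>?T\<close> are stretched by strictly less than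
      \<open>t\<close>, whereas those of \<open>S\<close> are stretched by at least
      \<open>t\<close>.\<close>
    let ?T = "span (v ` (- ?K))"
    have "S \<inter> ?T = {0}"
    proof -
      have "x = 0" if x: "x \<in> S" "x \<in> ?T" for x
      proof (rule ccontr)
        assume "x \<noteq> 0"
        have coord: "x \<bullet> v k = 0" if "k \<in> ?K" for k
          using orthonormal_inner_span_eq_0[OF on x(2)] that by blast
        \<comment> \<open>The index \<open>j\<close> serves twice: \<open>t\<close> exceeds the norm
          \<open>norm (A *v v j)\<close> and so is positive, and the summand at \<open>j\<close>
          makes the comparison of sums strict.\<close>
        obtain j where j: "x \<bullet> v j \<noteq> 0"
          using \<open>x \<noteq> 0\<close> norm_sq[of x] by fastforce
        then have "j \<notin> ?K" using coord by blast
        then have "0 < t"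
          using norm_ge_zero[of "A *v v j"] by (simp add: not_le del: norm_ge_zero)
        have "(norm (A *v x))\<^sup>2 = (\<Sum>k\<in>UNIV. (norm (A *v v k))\<^sup>2 * (x \<bullet> v k)\<^sup>2)"
          by (rule image_sq)
        also have "\<dots> < (\<Sum>k\<in>UNIV. t\<^sup>2 * (x \<bullet> v k)\<^sup>2)"
        proof (rule sum_strict_mono_ex1)
          show "\<forall>k\<in>UNIV. (norm (A *v v k))\<^sup>2 * (x \<bullet> v k)\<^sup>2 \<le> t\<^sup>2 * (x \<bullet> v k)\<^sup>2"
          proof
            fix k
            show "(norm (A *v v k))\<^sup>2 * (x \<bullet> v k)\<^sup>2 \<le> t\<^sup>2 * (x \<bullet> v k)\<^sup>2"
            proof (cases "k \<in> ?K")
              case False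
              then show ?thesis by (intro mult_right_mono power_mono) auto
            qed (simp add: coord)
          qed
          have "(norm (A *v v j))\<^sup>2 < t\<^sup>2"
            using \<open>j \<notin> ?K\<close> by (intro power_strict_mono) auto
          then show "\<exists>k\<in>UNIV. (norm (A *v v k))\<^sup>2 * (x \<bullet> v k)\<^sup>2 < t\<^sup>2 * (x \<bullet> v k)\<^sup>2"
            using j by (intro bexI[of _ j]) auto
        qed simp
        also have "\<dots> = (t * norm x)\<^sup>2"
          by (simp add: power_mult_distrib norm_sq sum_distrib_left)
        also have "\<dots> \<le> (norm (A *v x))\<^sup>2"
          using S(3)[OF x(1)] \<open>0 < t\<close> by (intro power_mono) auto
        finally show False by simp
      qed
      then show ?thesis
        using S(1) subspace_0 by (auto simp: span_zero)
    qed
    then have "dim S + dim ?T = dim {x + y |x y. x \<in> S \<and> y \<in> ?T}"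
      using dim_sums_Int[OF S(1) subspace_span, of "v ` (- ?K)"] by simp
    also have "\<dots> \<le> CARD('q)"
      by (rule dim_subset_UNIV_cart)
    finally have "dim S + card (- ?K) \<le> CARD('q)"
      by (simp only: orthonormal_dim_span[OF on])
    moreover have "card (- ?K) = CARD('q) - card ?K" "card ?K \<le> CARD('q)"
      by (simp_all add: Compl_eq_Diff_UNIV card_Diff_subset card_mono)
    ultimately have "i \<le> card ?K"
      using S(2) by linarith
    then show "t \<le> sing_val i A"
      using le_sing_val_iff_card[OF v i] by simp
  }
qed

text \<open>The line through \<open>x\<close> is a one-dimensional test subspace, with the
  stretching ratio of \<open>x\<close> as threshold.\<close>

lemma norm_mult_le_spectral_norm:
  fixes A :: "real^'q^'p"
  shows "norm (A *v x) \<le> spectral_norm A * norm x"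
proof (cases "x = 0")
  case False
  let ?t = "norm (A *v x) / norm x"
  have "?t \<le> sing_val 1 A"
  proof (subst le_sing_val_iff_subspace, simp, simp, intro exI conjI ballI)
    show "1 \<le> dim (span {x})"
      using False by (simp add: dim_span)
    fix y assume "y \<in> span {x}"
    then obtain c where "y = c *\<^sub>R x"
      by (auto simp: span_singleton)
    then show "?t * norm y \<le> norm (A *v y)"
      using False by (simp add: matrix_vector_mult_scaleR)
  qed simp
  then show ?thesis
    using False by (simp add: spectral_norm_def field_simps)
qed simp

lemma spectral_norm_nonneg: "0 \<le> spectral_norm (A :: real^'q^'p)"
proof -
  have "0 \<le> spectral_norm A * norm (axis undefined 1 :: real^'q)"
    using norm_mult_le_spectral_norm[of A "axis undefined 1"] norm_ge_zero order_trans by blast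
  then show ?thesis by (simp add: norm_axis_1)
qed

lemma spectral_norm_le_iff:
  fixes A :: "real^'q^'p"
  shows "spectral_norm A \<le> t \<longleftrightarrow> (\<forall>x. norm (A *v x) \<le> t * norm x)"
proof
  assume "spectral_norm A \<le> t"
  then have "spectral_norm A * norm x \<le> t * norm x" for x :: "real^'q"
    by (intro mult_right_mono) auto
  then show "\<forall>x. norm (A *v x) \<le> t * norm x"
    using norm_mult_le_spectral_norm order_trans by blast
next
  assume *: "\<forall>x. norm (A *v x) \<le> t * norm x"
  obtain S where S: "1 \<le> dim S" "\<And>x. x \<in> S \<Longrightarrow> spectral_norm A * norm x \<le> norm (A *v x)"
    using le_sing_val_iff_subspace[of 1 "spectral_norm A" A] by (auto simp: spectral_norm_def)
  then obtain x where x: "x \<in> S" "x \<noteq> 0"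
    by (metis dim_eq_0 not_one_le_zero subsetI singletonI)
  then have "spectral_norm A * norm x \<le> t * norm x"
    using S(2) * order_trans by blast
  then show "spectral_norm A \<le> t"
    using x(2) by simp
qed

section \<open>Duality of the nuclear and spectral norms\<close>

text \<open>The Frobenius inner product is a sum over rows; Parseval on each row and an exchange of
  sums give the trace formula in any orthonormal basis.\<close>

lemma inner_matrix_orthonormal:
  fixes Z B :: "real^'q^'p"
  assumes "orthonormal v"
  shows "Z \<bullet> B = (\<Sum>k\<in>UNIV. (Z *v v k) \<bullet> (B *v v k))"
proof -
  have "Z \<bullet> B = (\<Sum>i\<in>UNIV. \<Sum>k\<in>UNIV. (Z $ i \<bullet> v k) * (B $ i \<bullet> v k))"
    unfolding inner_vec_def[of Z B] by (intro sum.cong refl orthonormal_inner[OF assms])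
  also have "\<dots> = (\<Sum>k\<in>UNIV. \<Sum>i\<in>UNIV. (Z $ i \<bullet> v k) * (B $ i \<bullet> v k))"
    by (rule sum.swap)
  also have "\<dots> = (\<Sum>k\<in>UNIV. (Z *v v k) \<bullet> (B *v v k))"
    by (simp add: inner_vec_def[of "Z *v _"] matrix_vector_mul_component)
  finally show ?thesis .
qed

lemma inner_contraction_le:
  fixes Z B :: "real^'q^'p"
  assumes v: "orthonormal v" and Z: "\<And>x. norm (Z *v x) \<le> norm x"
  shows "(Z *v v k) \<bullet> (B *v v k) \<le> norm (B *v v k)"
proof -
  have "norm (v k) = 1"
    using v by (simp add: orthonormal_def norm_eq_1)
  then have "norm (Z *v v k) \<le> 1"
    using Z[of "v k"] by simp
  then have "norm (Z *v v k) * norm (B *v v k) \<le> 1 * norm (B *v v k)"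
    by (intro mult_right_mono) auto
  then show ?thesis
    using norm_cauchy_schwarz[of "Z *v v k" "B *v v k"] by linarith
qed

lemma inner_le_nuclear_norm:
  fixes Z B :: "real^'q^'p"
  assumes "\<And>x. norm (Z *v x) \<le> norm x"
  shows "Z \<bullet> B \<le> nuclear_norm B"
proof -
  obtain v where v: "right_singular_basis B v" by (rule right_singular_basis_exists)
  then have on: "orthonormal v" by (simp add: right_singular_basis_def)
  show ?thesis
    unfolding nuclear_norm_eq_sum[OF v] inner_matrix_orthonormal[OF on, of Z B]
    by (intro sum_mono inner_contraction_le on assms)
qed

text \<open>The maximiser is the partial isometry of the polar decomposition: it sends each right
  singular vector to the normalised image under \<open>B\<close>.\<close>

lemma nuclear_norm_attained:
  fixes B :: "real^'q^'p"
  obtains Z :: "real^'q^'p" where "\<And>x. norm (Z *v x) \<le> norm x" "Z \<bullet> B = nuclear_norm B"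
proof -
  obtain v where v: "right_singular_basis B v" by (rule right_singular_basis_exists)
  then have on: "orthonormal v" by (simp add: right_singular_basis_def)
  \<comment> \<open>If \<open>B *v v k = 0\<close>, then \<open>u k = 0\<close>, so no case
    distinction on the rank is needed.\<close>
  define u where "u k = (1 / norm (B *v v k)) *\<^sub>R (B *v v k)" for k
  define f where "f x = (\<Sum>k\<in>UNIV. (x \<bullet> v k) *\<^sub>R u k)" for x
  have "linear f"
    by (intro linearI)
      (simp_all add: f_def inner_add_left scaleR_add_left sum.distrib scaleR_sum_right)
  then have f: "matrix f *v x = f x" for x
    by (simp add: matrix_works)
  have "norm (f x) \<le> norm x" for x
  proof -
    have "pairwise (\<lambda>i j. orthogonal ((x \<bullet> v i) *\<^sub>R u i) ((x \<bullet> v j) *\<^sub>R u j)) UNIV"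
      using right_singular_basis_inner[OF v] by (auto simp: pairwise_def orthogonal_def u_def)
    then have "(norm (f x))\<^sup>2 = (\<Sum>k\<in>UNIV. (norm ((x \<bullet> v k) *\<^sub>R u k))\<^sup>2)"
      unfolding f_def by (intro norm_sum_Pythagorean) auto
    also have "\<dots> \<le> (\<Sum>k\<in>UNIV. (x \<bullet> v k)\<^sup>2)"
      by (intro sum_mono) (simp add: u_def power_mult_distrib power_divide)
    also have "\<dots> = (norm x)\<^sup>2"
      using orthonormal_inner[OF on, of x x] by (simp add: dot_square_norm power2_eq_square)
    finally show ?thesis
      by (rule power2_le_imp_le) simp
  qed
  moreover have "matrix f \<bullet> B = nuclear_norm B"
  proof -
    have "f (v k) \<bullet> (B *v v k) = norm (B *v v k)" for k
    proof -
      have "f (v k) = (\<Sum>j\<in>UNIV. if k = j then u j else 0)"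
        unfolding f_def using on by (intro sum.cong) (auto simp: orthonormal_def)
      then have "f (v k) = u k" by simp
      then show ?thesis
        by (simp add: u_def dot_square_norm power2_eq_square)
    qed
    then show ?thesis
      by (simp add: inner_matrix_orthonormal[OF on] nuclear_norm_eq_sum[OF v] f)
  qed
  ultimately show ?thesis
    using that[of "matrix f"] by (simp add: f)
qed

text \<open>As a maximum of the linear functionals given by contractions, the nuclear norm is
  sublinear: evaluate the maximiser for the sum on each summand.\<close>

lemma nuclear_norm_triangle: "nuclear_norm (A + B) \<le> nuclear_norm A + nuclear_norm B"
proof -
  obtain Z where Z: "\<And>x. norm (Z *v x) \<le> norm x" "Z \<bullet> (A + B) = nuclear_norm (A + B)"
    using nuclear_norm_attained by blast
  have "Z \<bullet> A \<le> nuclear_norm A" "Z \<bullet> B \<le> nuclear_norm B"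
    using Z(1) by (auto intro: inner_le_nuclear_norm)
  then show ?thesis using Z(2) by (simp add: inner_add_right)
qed

lemma nuclear_norm_scaleR_le:
  assumes "0 \<le> c"
  shows "nuclear_norm (c *\<^sub>R B) \<le> c * nuclear_norm B"
proof -
  obtain Z where Z: "\<And>x. norm (Z *v x) \<le> norm x" "Z \<bullet> (c *\<^sub>R B) = nuclear_norm (c *\<^sub>R B)"
    using nuclear_norm_attained by blast
  then have "nuclear_norm (c *\<^sub>R B) = c * (Z \<bullet> B)" by simp
  also have "\<dots> \<le> c * nuclear_norm B"
    using assms Z(1) by (intro mult_left_mono inner_le_nuclear_norm)
  finally show ?thesis .
qed

lemma inner_outer_product:
  fixes Z :: "real^'q^'p"
  shows "Z \<bullet> (\<chi> i j. u $ i * x $ j) = u \<bullet> (Z *v x)"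
  by (simp add: inner_vec_def matrix_vector_mult_def sum_distrib_left algebra_simps)

text \<open>Rank-one matrices are the test directions that convert a bound on pairings by the
  nuclear norm into a bound on the operator norm.\<close>

lemma nuclear_norm_outer_product_le:
  fixes u :: "real^'p" and x :: "real^'q"
  shows "nuclear_norm (\<chi> i j. u $ i * x $ j) \<le> norm u * norm x"
proof -
  obtain Z :: "real^'q^'p" where Z: "\<And>x. norm (Z *v x) \<le> norm x"
    "Z \<bullet> (\<chi> i j. u $ i * x $ j) = nuclear_norm (\<chi> i j. u $ i * x $ j)"
    using nuclear_norm_attained[where B = "\<chi> i j. u $ i * x $ j"] by blast
  have "u \<bullet> (Z *v x) \<le> norm u * norm (Z *v x)"
    by (rule norm_cauchy_schwarz)
  also have "\<dots> \<le> norm u * norm x"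
    by (intro mult_left_mono Z) auto
  finally show ?thesis
    using Z(2) by (simp add: inner_outer_product)
qed

lemma inner_matrix_mult_right:
  fixes X :: "real^'p^'n" and R :: "real^'q^'n" and D :: "real^'q^'p"
  shows "R \<bullet> (X ** D) = (transpose X ** R) \<bullet> D"
proof -
  have "R \<bullet> (X ** D) = (\<Sum>j\<in>UNIV. column j R \<bullet> (X *v column j D))"
    unfolding inner_vec_def matrix_matrix_mult_def matrix_vector_mult_def column_def
    by simp (rule sum.swap)
  also have "\<dots> = (\<Sum>j\<in>UNIV. (transpose X *v column j R) \<bullet> column j D)"
    by (simp only: transpose_inner)
  also have "\<dots> = (transpose X ** R) \<bullet> D"
    unfolding inner_vec_def matrix_matrix_mult_def matrix_vector_mult_def column_def
    by simp (rule sum.swap)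
  finally show ?thesis .
qed

section \<open>Optimality conditions\<close>

text \<open>Compare the objective at \<open>B\<close> and at \<open>B + t D\<close>, expand the
  square, and move \<open>X\<close> to the other side of the inner product as its adjoint.\<close>

lemma primal_solution_perturbation:
  assumes "primal_solution X Y lam B"
  shows "t * ((transpose X ** (Y - X ** B)) \<bullet> D) \<le>
    t\<^sup>2 * ((norm (X ** D))\<^sup>2 / 2) + lam * (nuclear_norm (B + t *\<^sub>R D) - nuclear_norm B)"
proof -
  let ?R = "Y - X ** B"
  have XBD: "X ** (B + t *\<^sub>R D) = X ** B + t *\<^sub>R (X ** D)"
    by (simp add: vec_eq_iff matrix_matrix_mult_def sum.distrib sum_distrib_left algebra_simps)
  have "Y - X ** (B + t *\<^sub>R D) = ?R - t *\<^sub>R (X ** D)"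
    unfolding XBD by simp
  moreover have "(norm (?R - t *\<^sub>R (X ** D)))\<^sup>2
      = (norm ?R)\<^sup>2 - 2 * t * (?R \<bullet> (X ** D)) + t\<^sup>2 * (norm (X ** D))\<^sup>2"
    by (simp add: power2_norm_diff power_mult_distrib)
  moreover have "primal_objective X Y lam B \<le> primal_objective X Y lam (B + t *\<^sub>R D)"
    using assms by (auto simp: primal_solution_def is_arg_min_def not_less)
  ultimately have "t * (?R \<bullet> (X ** D)) \<le>
    t\<^sup>2 * ((norm (X ** D))\<^sup>2 / 2) + lam * (nuclear_norm (B + t *\<^sub>R D) - nuclear_norm B)"
    by (simp add: primal_objective_def algebra_simps)
  then show ?thesis
    by (simp only: inner_matrix_mult_right)
qed

lemma primal_solution_residual_inner_le:
  assumes B: "primal_solution X Y lam B" and "0 < lam"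
  shows "(transpose X ** (Y - X ** B)) \<bullet> D \<le> lam * nuclear_norm D"
proof -
  let ?G = "transpose X ** (Y - X ** B)"
  have "?G \<bullet> D - lam * nuclear_norm D \<le> 0"
  proof (rule nonpos_if_quadratic_bound)
    fix t :: real assume t: "0 < t" "t \<le> 1"
    have "nuclear_norm (B + t *\<^sub>R D) - nuclear_norm B \<le> t * nuclear_norm D"
      using nuclear_norm_triangle[of B "t *\<^sub>R D"] nuclear_norm_scaleR_le[of t D] t by simp
    then have "lam * (nuclear_norm (B + t *\<^sub>R D) - nuclear_norm B) \<le> lam * (t * nuclear_norm D)"
      using \<open>0 < lam\<close> by (intro mult_left_mono) auto
    then show "t * (?G \<bullet> D - lam * nuclear_norm D) \<le> t\<^sup>2 * ((norm (X ** D))\<^sup>2 / 2)"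
      using primal_solution_perturbation[OF B, of t D] by (simp add: algebra_simps)
  qed
  then show ?thesis by simp
qed

text \<open>The missing inequality comes from the direction \<open>- B\<close>, which merely shrinks
  \<open>B\<close> to \<open>(1 - t) B\<close> and so lowers the nuclear norm at least linearly in
  \<open>t\<close>.\<close>

lemma primal_solution_residual_inner_eq:
  assumes B: "primal_solution X Y lam B" and "0 < lam"
  shows "(transpose X ** (Y - X ** B)) \<bullet> B = lam * nuclear_norm B"
proof (rule antisym)
  let ?G = "transpose X ** (Y - X ** B)"
  show "?G \<bullet> B \<le> lam * nuclear_norm B"
    by (rule primal_solution_residual_inner_le[OF assms])
  have "lam * nuclear_norm B - ?G \<bullet> B \<le> 0"
  proof (rule nonpos_if_quadratic_bound)
    fix t :: real assume t: "0 < t" "t \<le> 1"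
    have "B + t *\<^sub>R (- B) = (1 - t) *\<^sub>R B"
      by (simp add: algebra_simps)
    then have "nuclear_norm (B + t *\<^sub>R (- B)) - nuclear_norm B \<le> - (t * nuclear_norm B)"
      using nuclear_norm_scaleR_le[of "1 - t" B] t by (simp add: algebra_simps)
    then have "lam * (nuclear_norm (B + t *\<^sub>R (- B)) - nuclear_norm B) \<le> lam * - (t * nuclear_norm B)"
      using \<open>0 < lam\<close> by (intro mult_left_mono) auto
    then show "t * (lam * nuclear_norm B - ?G \<bullet> B) \<le> t\<^sup>2 * ((norm (X ** (- B)))\<^sup>2 / 2)"
      using primal_solution_perturbation[OF B, of t "- B"] by (simp add: algebra_simps)
  qed
  then show "lam * nuclear_norm B \<le> ?G \<bullet> B" by simp
qed

text \<open>Pair the gradient with the outer product of \<open>?u\<close> and \<open>x\<close>,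
  where \<open>?u\<close> is the image of \<open>x\<close>: the pairing is the squared norm of
  \<open>?u\<close>, and one factor cancels.\<close>

lemma primal_solution_residual_norm_le:
  assumes "primal_solution X Y lam B" "0 < lam"
  shows "norm ((transpose X ** (Y - X ** B)) *v x) \<le> lam * norm x"
proof -
  let ?u = "(transpose X ** (Y - X ** B)) *v x"
  have "norm ?u * norm ?u = ?u \<bullet> ?u"
    by (simp add: dot_square_norm power2_eq_square)
  also have "\<dots> \<le> lam * nuclear_norm (\<chi> i j. ?u $ i * x $ j)"
    using primal_solution_residual_inner_le[OF assms, of "\<chi> i j. ?u $ i * x $ j"]
    by (simp only: inner_outer_product)
  also have "\<dots> \<le> lam * (norm ?u * norm x)"
    using assms(2) by (intro mult_left_mono nuclear_norm_outer_product_le) auto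
  finally have "norm ?u * norm ?u \<le> norm ?u * (lam * norm x)"
    by (simp add: mult.left_commute)
  then show ?thesis
    using assms(2) by (cases "norm ?u = 0") (auto simp: mult_le_cancel_left)
qed

text \<open>Equality of the pairing with the nuclear norm forces equality in the Cauchy-Schwarz
  estimate for every \<open>k\<close>. Hence \<open>W\<close> sends the right singular vectors
  outside the kernel of \<open>B\<close> to the normalised images under \<open>B\<close>, which are
  again orthonormal.\<close>

lemma nuclear_subgradient_isometric:
  fixes B W :: "real^'q^'p"
  assumes v: "right_singular_basis B v" and W: "\<And>x. norm (W *v x) \<le> norm x"
    and eq: "W \<bullet> B = nuclear_norm B" and x: "x \<in> span (v ` {k. B *v v k \<noteq> 0})"
  shows "norm (W *v x) = norm x"
proof -
  have on: "orthonormal v" using v by (simp add: right_singular_basis_def)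
  let ?K = "{k. B *v v k \<noteq> 0}"
  have "(\<Sum>k\<in>UNIV. norm (B *v v k) - (W *v v k) \<bullet> (B *v v k)) = 0"
    using eq by (simp add: sum_subtractf nuclear_norm_eq_sum[OF v] inner_matrix_orthonormal[OF on])
  then have WB: "(W *v v k) \<bullet> (B *v v k) = norm (B *v v k)" for k
    by (subst (asm) sum_nonneg_eq_0_iff) (auto simp: inner_contraction_le[OF on W])
  \<comment> \<open>Equality case of Cauchy-Schwarz, obtained by expanding the squared norm of the
    difference; multiplying by the norm keeps the claim valid when
    \<open>B *v v k = 0\<close>.\<close>
  have scaled: "norm (B *v v k) *\<^sub>R (W *v v k) = B *v v k" for k
  proof -
    let ?b = "norm (B *v v k)"
    have "norm (v k) = 1"
      using on by (simp add: orthonormal_def norm_eq_1)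
    then have "(norm (W *v v k))\<^sup>2 \<le> 1"
      using W[of "v k"] by (simp add: power_le_one)
    then have "?b\<^sup>2 * (norm (W *v v k))\<^sup>2 \<le> ?b\<^sup>2 * 1"
      by (intro mult_left_mono) auto
    moreover have "(norm (?b *\<^sub>R (W *v v k) - B *v v k))\<^sup>2
        = ?b\<^sup>2 * (norm (W *v v k))\<^sup>2 - 2 * ?b * ((W *v v k) \<bullet> (B *v v k)) + ?b\<^sup>2"
      by (simp add: power2_norm_diff power_mult_distrib dot_square_norm)
    ultimately have "(norm (?b *\<^sub>R (W *v v k) - B *v v k))\<^sup>2 \<le> 0"
      by (simp add: WB power2_eq_square)
    then show ?thesis by simp
  qed
  have WW: "(W *v v j) \<bullet> (W *v v k) = (if j = k then 1 else 0)" if "j \<in> ?K" "k \<in> ?K" for j k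
  proof -
    let ?a = "norm (B *v v j)" and ?b = "norm (B *v v k)"
    have "?a * ?b * ((W *v v j) \<bullet> (W *v v k)) = (?a *\<^sub>R (W *v v j)) \<bullet> (?b *\<^sub>R (W *v v k))"
      by simp
    also have "\<dots> = ?a * ?b * (if j = k then 1 else 0)"
      unfolding scaled right_singular_basis_inner[OF v] by (simp add: power2_eq_square)
    finally show ?thesis using that by simp
  qed
  have coord: "x \<bullet> v k = 0" if "k \<notin> ?K" for k
    by (rule orthonormal_inner_span_eq_0[OF on x that])
  have "W *v x = W *v (\<Sum>k\<in>UNIV. (x \<bullet> v k) *\<^sub>R v k)"
    using orthonormal_expansion[OF on, of x] by simp
  also have "\<dots> = (\<Sum>k\<in>UNIV. (x \<bullet> v k) *\<^sub>R (W *v v k))"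
    by (simp add: linear_sum matrix_vector_mult_scaleR)
  finally have Wx: "W *v x = (\<Sum>k\<in>UNIV. (x \<bullet> v k) *\<^sub>R (W *v v k))" .
  have "(norm (W *v x))\<^sup>2 = (\<Sum>k\<in>UNIV. (norm ((x \<bullet> v k) *\<^sub>R (W *v v k)))\<^sup>2)"
    unfolding Wx
  proof (rule norm_sum_Pythagorean)
    show "pairwise (\<lambda>i j. orthogonal ((x \<bullet> v i) *\<^sub>R (W *v v i)) ((x \<bullet> v j) *\<^sub>R (W *v v j))) UNIV"
    proof (rule pairwiseI)
      fix i j :: 'q assume "i \<noteq> j"
      then show "orthogonal ((x \<bullet> v i) *\<^sub>R (W *v v i)) ((x \<bullet> v j) *\<^sub>R (W *v v j))"
        using coord WW[of i j] by (cases "i \<in> ?K"; cases "j \<in> ?K") (simp_all add: orthogonal_def)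
    qed
  qed simp
  also have "\<dots> = (\<Sum>k\<in>UNIV. (x \<bullet> v k)\<^sup>2)"
  proof (rule sum.cong)
    fix k
    show "(norm ((x \<bullet> v k) *\<^sub>R (W *v v k)))\<^sup>2 = (x \<bullet> v k)\<^sup>2"
      using coord[of k] WW[of k k] by (cases "k \<in> ?K") (simp_all add: norm_eq_sqrt_inner)
  qed simp
  also have "\<dots> = (norm x)\<^sup>2"
    using orthonormal_inner[OF on, of x x] by (simp add: dot_square_norm power2_eq_square)
  finally show ?thesis by simp
qed

section \<open>The dual problem\<close>

text \<open>Read pointwise in \<open>x\<close>, the spectral constraint becomes an intersection of
  closed convex conditions on \<open>C\<close>.\<close>

lemma dual_feasible_iff:
  "C \<in> dual_feasible X \<longleftrightarrow> (\<forall>x. norm (transpose X *v (C *v x)) \<le> norm x)"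
  by (simp add: dual_feasible_def spectral_norm_le_iff matrix_vector_mul_assoc)

lemma convex_dual_feasible:
  fixes X :: "real^'p^'n"
  shows "convex (dual_feasible X :: (real^'q^'n) set)"
proof (rule convexI)
  fix C D :: "real^'q^'n" and a b :: real
  assume *: "C \<in> dual_feasible X" "D \<in> dual_feasible X" "0 \<le> a" "0 \<le> b" "a + b = 1"
  show "a *\<^sub>R C + b *\<^sub>R D \<in> dual_feasible X"
    unfolding dual_feasible_iff
  proof
    fix x
    have "norm (transpose X *v ((a *\<^sub>R C + b *\<^sub>R D) *v x))
        = norm (a *\<^sub>R (transpose X *v (C *v x)) + b *\<^sub>R (transpose X *v (D *v x)))"
      by (simp only: matrix_vector_mult_add_rdistrib scaleR_matrix_vector_assoc[symmetric]
          matrix_vector_right_distrib matrix_vector_mult_scaleR)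
    also have "\<dots> \<le> a * norm (transpose X *v (C *v x)) + b * norm (transpose X *v (D *v x))"
      using * by (intro norm_triangle_le) simp
    also have "\<dots> \<le> a * norm x + b * norm x"
      using * by (intro add_mono mult_left_mono) (auto simp only: dual_feasible_iff)
    also have "\<dots> = norm x"
      using * by (simp flip: distrib_right)
    finally show "norm (transpose X *v ((a *\<^sub>R C + b *\<^sub>R D) *v x)) \<le> norm x" .
  qed
qed

lemma closed_dual_feasible:
  fixes X :: "real^'p^'n"
  shows "closed (dual_feasible X :: (real^'q^'n) set)"
proof -
  have "linear (\<lambda>C :: real^'q^'n. transpose X *v (C *v x))" for x
    by (intro linearI)
      (simp_all only: matrix_vector_mult_add_rdistrib scaleR_matrix_vector_assoc[symmetric]
          matrix_vector_right_distrib matrix_vector_mult_scaleR)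
  then have "continuous_on UNIV (\<lambda>C :: real^'q^'n. transpose X *v (C *v x))" for x
    by (simp add: linear_continuous_on linear_conv_bounded_linear)
  then have "closed {C :: real^'q^'n. norm (transpose X *v (C *v x)) \<le> norm x}" for x
    by (intro closed_Collect_le continuous_on_norm continuous_on_const)
  moreover have "dual_feasible X = (\<Inter>x. {C :: real^'q^'n. norm (transpose X *v (C *v x)) \<le> norm x})"
    by (auto simp: dual_feasible_iff)
  ultimately show ?thesis by auto
qed

text \<open>The obtuse-angle criterion for the projection onto a closed convex set.\<close>

lemma dual_solution_variational:
  assumes "dual_solution X Y lam C" "0 < lam" "D \<in> dual_feasible X"
  shows "C \<in> dual_feasible X" "((1 / lam) *\<^sub>R Y - C) \<bullet> (D - C) \<le> 0"
proof -
  have *: "C \<in> dual_feasible X" "\<forall>Z\<in>dual_feasible X. dist ((1 / lam) *\<^sub>R Y) C \<le> dist ((1 / lam) *\<^sub>R Y) Z"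
    using assms(1) unfolding dual_solution_iff_projection[OF assms(2)] is_arg_min_def
    by (auto simp: not_less)
  then show "C \<in> dual_feasible X" by simp
  show "((1 / lam) *\<^sub>R Y - C) \<bullet> (D - C) \<le> 0"
    using * assms(3) by (intro any_closest_point_dot[OF convex_dual_feasible closed_dual_feasible]) auto
qed

text \<open>The third conclusion identifies \<open>C\<close> as the projection of \<open>Y / lam\<close> onto the dual feasible
  set, i.e. as the paper's \<open>C\<^sup>*(\<lambda>)\<close>.\<close>

lemma primal_solution_variational:
  fixes X :: "real^'p^'n" and Y C D :: "real^'q^'n" and B :: "real^'q^'p"
  assumes B: "primal_solution X Y lam B" "0 < lam"
    and C: "C = (1 / lam) *\<^sub>R (Y - X ** B)"
  shows "C \<in> dual_feasible X" "(transpose X ** C) \<bullet> B = nuclear_norm B"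
    "D \<in> dual_feasible X \<Longrightarrow> ((1 / lam) *\<^sub>R Y - C) \<bullet> (D - C) \<le> 0"
proof -
  have XC: "transpose X ** C = (1 / lam) *\<^sub>R (transpose X ** (Y - X ** B))"
    unfolding C by (simp add: vec_eq_iff matrix_matrix_mult_def sum_distrib_left algebra_simps)
  show "C \<in> dual_feasible X"
    unfolding dual_feasible_iff
  proof
    fix x
    have "transpose X *v (C *v x) = (1 / lam) *\<^sub>R ((transpose X ** (Y - X ** B)) *v x)"
      by (simp only: matrix_vector_mul_assoc XC scaleR_matrix_vector_assoc)
    then show "norm (transpose X *v (C *v x)) \<le> norm x"
      using primal_solution_residual_norm_le[OF B, of x] B(2) by (simp add: field_simps)
  qed
  show eq: "(transpose X ** C) \<bullet> B = nuclear_norm B"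
    using primal_solution_residual_inner_eq[OF B] B(2) by (simp add: XC)
  assume D: "D \<in> dual_feasible X"
  \<comment> \<open>The vector from \<open>C\<close> to the projected point is a multiple of
    \<open>X ** B\<close>. The inequality thus reduces to the fact that a contraction pairs with
    \<open>B\<close> to at most the nuclear norm, a value that \<open>C\<close> attains.\<close>
  have "(1 / lam) *\<^sub>R Y - C = (1 / lam) *\<^sub>R (X ** B)"
    unfolding C by (simp add: algebra_simps)
  then have "((1 / lam) *\<^sub>R Y - C) \<bullet> (D - C) = (1 / lam) * (D \<bullet> (X ** B) - C \<bullet> (X ** B))"
    by (simp add: inner_diff_right inner_commute)
  also have "\<dots> = (1 / lam) * ((transpose X ** D) \<bullet> B - nuclear_norm B)"
    by (simp only: inner_matrix_mult_right eq)
  also have "\<dots> \<le> 0"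
    using B(2) D inner_le_nuclear_norm[of "transpose X ** D" B]
    by (intro mult_nonneg_nonpos) (auto simp: dual_feasible_iff matrix_vector_mul_assoc)
  finally show "((1 / lam) *\<^sub>R Y - C) \<bullet> (D - C) \<le> 0" .
qed

section \<open>Localising the dual optimum and transferring singular value bounds\<close>

text \<open>Here \<open>c\<close> and \<open>d\<close> play the projections of \<open>a\<close> and
  \<open>b\<close>. Adding the two inequalities bounds the squared norm of \<open>c - d\<close> by
  \<open>(a - b) \<bullet> (c - d)\<close>; completing the square turns this into a ball.\<close>

lemma firmly_nonexpansive_ball:
  fixes a b c d :: "'a::real_inner"
  assumes "(a - c) \<bullet> (d - c) \<le> 0" "(b - d) \<bullet> (c - d) \<le> 0"
  shows "norm (c - (d + (1/2) *\<^sub>R (a - b))) \<le> norm (a - b) / 2"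
proof -
  have "(c - d) \<bullet> (c - d) \<le> (a - b) \<bullet> (c - d)"
    using assms by (simp add: algebra_simps inner_commute)
  moreover have "(norm (c - (d + (1/2) *\<^sub>R (a - b))))\<^sup>2
      = (c - d) \<bullet> (c - d) - (a - b) \<bullet> (c - d) + (norm (a - b) / 2)\<^sup>2"
  proof -
    have "c - (d + (1/2) *\<^sub>R (a - b)) = (c - d) - (1/2) *\<^sub>R (a - b)"
      by simp
    then show ?thesis
      by (simp only: power2_norm_diff[of "c - d"])
        (simp add: inner_commute[of "c - d" "a - b"] power2_eq_square dot_square_norm)
  qed
  ultimately have "(norm (c - (d + (1/2) *\<^sub>R (a - b))))\<^sup>2 \<le> (norm (a - b) / 2)\<^sup>2"
    by linarith
  then show ?thesis
    by (rule power2_le_imp_le) simp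
qed

text \<open>With \<open>?z\<close> the image of \<open>y\<close>, the squared norm of
  \<open>?z\<close> equals \<open>y \<bullet> (X *v ?z)\<close>; one factor \<open>norm ?z\<close>
  cancels.\<close>

lemma norm_transpose_mult_le:
  fixes X :: "real^'p^'n"
  shows "norm (transpose X *v y) \<le> spectral_norm X * norm y"
proof -
  let ?z = "transpose X *v y"
  have "norm ?z * norm ?z = y \<bullet> (X *v ?z)"
    by (simp only: transpose_inner[symmetric] dot_square_norm power2_eq_square)
  also have "\<dots> \<le> norm y * norm (X *v ?z)"
    by (rule norm_cauchy_schwarz)
  also have "\<dots> \<le> norm y * (spectral_norm X * norm ?z)"
    by (intro mult_left_mono norm_mult_le_spectral_norm) auto
  finally have "norm ?z * norm ?z \<le> norm ?z * (spectral_norm X * norm y)"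
    by (simp only: mult_ac)
  then show ?thesis
    using spectral_norm_nonneg[of X] by (cases "?z = 0") auto
qed

lemma norm_mult_le_norm_matrix:
  fixes A :: "real^'q^'n"
  shows "norm (A *v x) \<le> norm A * norm x"
proof -
  have "norm (A *v x) = L2_set (\<lambda>i. norm (A $ i \<bullet> x)) UNIV"
    by (simp add: norm_vec_def[of "A *v x"] matrix_vector_mul_component)
  also have "\<dots> \<le> L2_set (\<lambda>i. norm (A $ i) * norm x) UNIV"
    by (intro L2_set_mono) (auto simp: Cauchy_Schwarz_ineq2)
  also have "\<dots> = norm A * norm x"
    by (simp add: norm_vec_def[of A] L2_set_left_distrib)
  finally show ?thesis .
qed

text \<open>The conclusion covers every primal minimiser \<open>B\<close>. With a zero or negative
  denominator the quotient would be at most 0 (division by zero yields 0), so the bound would hold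
  for every positive \<open>lam\<close>; \<open>denom_pos\<close> excludes this reading.\<close>

theorem theorem3p5:
  fixes X :: "real^'p^'n" and Y :: "real^'q^'n"
    and C0 :: "real^'q^'n" and B :: "real^'q^'p"
    and lam lam0 :: real and i :: nat
  assumes lam0: "0 < lam0" "lam0 \<le> spectral_norm (transpose X ** Y)"
    and C0: "dual_solution X Y lam0 C0"
    and i: "1 \<le> i" "i \<le> min CARD('p) CARD('q)"
    and lam: "0 < lam" "lam < lam0"
    and denom_pos: "2 * lam0
          - 2 * lam0 * sing_val i (transpose X ** (C0 + (1/2 * (1/lam - 1/lam0)) *\<^sub>R Y))
          + spectral_norm X * norm Y > 0"
    and lam_gt: "lam > lam0 * spectral_norm X * norm Y /
         (2 * lam0
          - 2 * lam0 * sing_val i (transpose X ** (C0 + (1/2 * (1/lam - 1/lam0)) *\<^sub>R Y))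
          + spectral_norm X * norm Y)"
    and B: "primal_solution X Y lam B"
  shows "(\<forall>j. i \<le> j \<and> j \<le> min CARD('p) CARD('q) \<longrightarrow> sing_val j B = 0) \<and> rank B \<le> i - 1"
proof -
  define C where "C = (1 / lam) *\<^sub>R (Y - X ** B)"
  define M where "M = C0 + (1/2 * (1/lam - 1/lam0)) *\<^sub>R Y"
  \<comment> \<open>\<open>spectral_norm X\<close> times the radius of the ball: how far the images
    of a unit vector under \<open>transpose X ** C\<close> and \<open>transpose X ** M\<close> can
    lie apart.\<close>
  define k where "k = spectral_norm X * norm Y * ((1/lam - 1/lam0) / 2)"
  \<comment> \<open>Clearing denominators shows that the threshold on \<open>lam\<close> is
    precisely this inequality.\<close>
  have \<sigma>: "sing_val i (transpose X ** M) < 1 - k"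
  proof -
    have "lam0 * spectral_norm X * norm Y <
        lam * (2 * lam0 - 2 * lam0 * sing_val i (transpose X ** M) + spectral_norm X * norm Y)"
      using lam_gt denom_pos by (simp add: M_def pos_divide_less_eq)
    then have "spectral_norm X * norm Y * (lam0 - lam) <
        2 * lam * lam0 * (1 - sing_val i (transpose X ** M))"
      by (simp add: algebra_simps)
    moreover have "spectral_norm X * norm Y * (lam0 - lam) = 2 * lam * lam0 * k"
      using lam lam0(1) by (simp add: k_def field_simps)
    ultimately show ?thesis
      using lam lam0(1) by (simp add: mult_less_cancel_left)
  qed
  note vi = primal_solution_variational[OF B lam(1) C_def]
  have C0_feasible: "C0 \<in> dual_feasible X"
    by (rule dual_solution_variational(1)[OF C0 lam0(1) vi(1)])
  \<comment> \<open>The ball lemma with \<open>a\<close> and \<open>b\<close> the two rescalings of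
    \<open>Y\<close>, \<open>c = C\<close> and \<open>d = C0\<close>; the centre is then
    \<open>M\<close>.\<close>
  have "norm (C - M) \<le> norm (((1 / lam) *\<^sub>R Y - (1 / lam0) *\<^sub>R Y)) / 2"
    using firmly_nonexpansive_ball[OF vi(3)[OF C0_feasible]
        dual_solution_variational(2)[OF C0 lam0(1) vi(1)]]
    by (simp only: M_def scaleR_diff_left[symmetric] scaleR_scaleR)
  also have "\<dots> = norm Y * ((1/lam - 1/lam0) / 2)"
    using lam by (simp add: scaleR_diff_left[symmetric] frac_le)
  finally have CM: "norm (C - M) \<le> norm Y * ((1/lam - 1/lam0) / 2)" .
  have diff: "norm ((transpose X ** C) *v x) - norm ((transpose X ** M) *v x) \<le> k * norm x" for x
  proof -
    have "norm ((transpose X ** C) *v x) - norm ((transpose X ** M) *v x)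
        \<le> norm ((transpose X ** C) *v x - (transpose X ** M) *v x)"
      by (rule norm_triangle_ineq2)
    also have "(transpose X ** C) *v x - (transpose X ** M) *v x = transpose X *v ((C - M) *v x)"
      by (simp only: matrix_vector_mul_assoc[symmetric] matrix_vector_mult_diff_rdistrib
          matrix_vector_mult_diff_distrib)
    also have "norm \<dots> \<le> spectral_norm X * norm ((C - M) *v x)"
      by (rule norm_transpose_mult_le)
    also have "\<dots> \<le> spectral_norm X * (norm (C - M) * norm x)"
      by (intro mult_left_mono norm_mult_le_norm_matrix spectral_norm_nonneg)
    also have "\<dots> \<le> spectral_norm X * (norm Y * ((1/lam - 1/lam0) / 2) * norm x)"
      by (intro mult_left_mono mult_right_mono CM spectral_norm_nonneg norm_ge_zero)
    finally show ?thesis by (simp only: k_def mult.assoc)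
  qed
  obtain v where v: "right_singular_basis B v" by (rule right_singular_basis_exists)
  \<comment> \<open>The \<open>k\<close> in this set is a bound index, unrelated to the real number
    \<open>k\<close> above.\<close>
  let ?K = "{k. B *v v k \<noteq> 0}"
  have card: "card ?K < i"
  proof (rule ccontr)
    assume "\<not> card ?K < i"
    moreover have "dim (span (v ` ?K)) = card ?K"
      using v by (intro orthonormal_dim_span) (simp add: right_singular_basis_def)
    ultimately have "i \<le> dim (span (v ` ?K))" by linarith
    \<comment> \<open>On this span \<open>transpose X ** C\<close> preserves norms, and replacing
      \<open>C\<close> by \<open>M\<close> costs at most \<open>k * norm x\<close>.\<close>
    moreover have "(1 - k) * norm x \<le> norm ((transpose X ** M) *v x)" if "x \<in> span (v ` ?K)" for x
    proof -
      have "norm ((transpose X ** C) *v x) = norm x"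
        using vi(1,2) that
        by (intro nuclear_subgradient_isometric[OF v])
          (simp_all only: dual_feasible_iff matrix_vector_mul_assoc)
      then show ?thesis using diff[of x] by (simp add: algebra_simps)
    qed
    ultimately have "1 - k \<le> sing_val i (transpose X ** M)"
      using le_sing_val_iff_subspace[OF i] subspace_span by blast
    then show False using \<sigma> by simp
  qed
  have "sing_val j B = 0" if j: "i \<le> j" "j \<le> min CARD('p) CARD('q)" for j
  proof (rule ccontr)
    have j1: "1 \<le> j" using i j by simp
    have "0 \<le> sing_val j B"
      using le_sing_val_iff_card[OF v j1 j(2), of 0] j(2) by simp
    moreover assume "sing_val j B \<noteq> 0"
    ultimately have "0 < sing_val j B" by simp
    \<comment> \<open>A positive \<open>j\<close>-th singular value would put at least
      \<open>j\<close> indices into \<open>?K\<close>, but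
      \<open>card ?K < i \<le> j\<close>.\<close>
    then have "card {k. sing_val j B \<le> norm (B *v v k)} \<le> card ?K"
      by (intro card_mono) auto
    moreover have "j \<le> card {k. sing_val j B \<le> norm (B *v v k)}"
      using le_sing_val_iff_card[OF v j1 j(2), of "sing_val j B"] by simp
    ultimately show False using card j(1) by linarith
  qed
  moreover have "rank B \<le> i - 1"
    using rank_le_card_nonzero_singular[OF v] card by linarith
  ultimately show ?thesis by blast
qed

end
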